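(* Let $k$ be a positive integer and $n \geq 2k+3$. Then, for each choice of sign $\pm$, $$1^k R_{n,1}^{B,>,\pm} + 3^k R_{n,3}^{B,>,\pm} + 5^k R_{n,5}^{B,>,\pm} + \cdots = 2^k R_{n,2}^{B,>,\pm} + 4^k R_{n,4}^{B,>,\pm} + 6^k R_{n,6}^{B,>,\pm} + \cdots,$$ $$1^k R_{n,1}^{B,<,\pm} + 3^k R_{n,3}^{B,<,\pm} + 5^k R_{n,5}^{B,<,\pm} + \cdots = 2^k R_{n,2}^{B,<,\pm} + 4^k R_{n,4}^{B,<,\pm} + 6^k R_{n,6}^{B,<,\pm} + \cdots.$$
   Context: $\mathfrak{B}_n$ is the set of signed permutations of $[n]$, written as words $\pi = \pi_1,\ldots,\pi_n$ with $\pi_i \in \{\pm 1,\ldots,\pm n\}$ and $|\pi_1|,\ldots,|\pi_n|$ a permutation of $[n]$. Set $\pi_0 = 0$. For $1 \leq i \leq n-1$, $\pi$ changes direction at $i$ if $\pi_{i-1} < \pi_i > \pi_{i+1}$ or $\pi_{i-1} > \pi_i < \pi_{i+1}$; $\mathrm{altruns}_B(\pi)$ is $1$ plus the number of such indices. $\mathsf{Negs}(\pi) = \{\pi_i : \pi_i < 0\}$ and $\mathsf{inv}_B(\pi) = |\{1 \le i<j \le n : \pi_i > \pi_j\}| + |\{1 \le i<j \le n : -\pi_i > \pi_j\}| + |\mathsf{Negs}(\pi)|$. Let $\mathfrak{B}_n^+$ (resp. $\mathfrak{B}_n^-$) be the set of $\pi$ with $\mathsf{inv}_B(\pi)$ even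 (resp. odd), $\mathfrak{B}_n^> = \{\pi : \pi_1 > 0\}$, $\mathfrak{B}_n^< = \{\pi : \pi_1 < 0\}$, $\mathfrak{B}_n^{>,\pm} = \mathfrak{B}_n^> \cap \mathfrak{B}_n^{\pm}$, $\mathfrak{B}_n^{<,\pm} = \mathfrak{B}_n^< \cap \mathfrak{B}_n^{\pm}$. $R_{n,i}^{B,>,\pm}$ (resp. $R_{n,i}^{B,<,\pm}$) is the number of $\pi \in \mathfrak{B}_n^{>,\pm}$ (resp. $\mathfrak{B}_n^{<,\pm}$) with $\mathrm{altruns}_B(\pi) = i$. *)

theory Defs
  imports Main
begin

text \<open>A signed permutation of \<open>[n]\<close> is the word \<open>\<pi> 1, \<dots>, \<pi> n\<close>. Fixing the value 0 outside
  \<open>{1..n}\<close> makes the function representing a word unique and builds in the convention \<open>\<pi> 0 = 0\<close>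
  used by \<open>changes_direction\<close>.\<close>

definition signed_perms :: "nat \<Rightarrow> (nat \<Rightarrow> int) set" where
  "signed_perms n =
     {\<pi>. (\<forall>i. i \<notin> {1..n} \<longrightarrow> \<pi> i = 0) \<and> bij_betw (\<lambda>i. \<bar>\<pi> i\<bar>) {1..n} {1..int n}}"

definition changes_direction :: "(nat \<Rightarrow> int) \<Rightarrow> nat \<Rightarrow> bool" where
  "changes_direction \<pi> i \<longleftrightarrow>
     (\<pi> (i - 1) < \<pi> i \<and> \<pi> i > \<pi> (i + 1)) \<or> (\<pi> (i - 1) > \<pi> i \<and> \<pi> i < \<pi> (i + 1))"

definition altruns_B :: "nat \<Rightarrow> (nat \<Rightarrow> int) \<Rightarrow> nat" where
  "altruns_B n \<pi> = 1 + card {i. 1 \<le> i \<and> i \<le> n - 1 \<and> changes_direction \<pi> i}"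

definition Negs :: "nat \<Rightarrow> (nat \<Rightarrow> int) \<Rightarrow> int set" where
  "Negs n \<pi> = {\<pi> i | i. i \<in> {1..n} \<and> \<pi> i < 0}"

definition inv_B :: "nat \<Rightarrow> (nat \<Rightarrow> int) \<Rightarrow> nat" where
  "inv_B n \<pi> =
     card {(i, j). 1 \<le> i \<and> i < j \<and> j \<le> n \<and> \<pi> i > \<pi> j}
     + card {(i, j). 1 \<le> i \<and> i < j \<and> j \<le> n \<and> - \<pi> i > \<pi> j}
     + card (Negs n \<pi>)"

datatype sign = Plus | Minus

fun signed_perms_sign :: "sign \<Rightarrow> nat \<Rightarrow> (nat \<Rightarrow> int) set" where
  "signed_perms_sign Plus n = {\<pi> \<in> signed_perms n. even (inv_B n \<pi>)}"
| "signed_perms_sign Minus n = {\<pi> \<in> signed_perms n. odd (inv_B n \<pi>)}"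

definition signed_perms_gt :: "nat \<Rightarrow> (nat \<Rightarrow> int) set" where
  "signed_perms_gt n = {\<pi> \<in> signed_perms n. \<pi> 1 > 0}"

definition signed_perms_lt :: "nat \<Rightarrow> (nat \<Rightarrow> int) set" where
  "signed_perms_lt n = {\<pi> \<in> signed_perms n. \<pi> 1 < 0}"

definition R_B_gt :: "sign \<Rightarrow> nat \<Rightarrow> nat \<Rightarrow> nat" where
  "R_B_gt s n i = card {\<pi> \<in> signed_perms_gt n \<inter> signed_perms_sign s n. altruns_B n \<pi> = i}"

definition R_B_lt :: "sign \<Rightarrow> nat \<Rightarrow> nat \<Rightarrow> nat" where
  "R_B_lt s n i = card {\<pi> \<in> signed_perms_lt n \<inter> signed_perms_sign s n. altruns_B n \<pi> = i}"

text \<open>The numbers \<open>R_B_gt s n i\<close> and \<open>R_B_lt s n i\<close> vanish for \<open>i > n\<close>, so a sum over all odd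
  (or all even) \<open>i\<close> may be cut off at \<open>n\<close>.\<close>

lemma altruns_B_le:
  assumes "n \<ge> 1"
  shows "altruns_B n \<pi> \<le> n"
proof -
  have "card {i. 1 \<le> i \<and> i \<le> n - 1 \<and> changes_direction \<pi> i} \<le> card {1..n - 1}"
    by (rule card_mono) auto
  then show ?thesis
    using assms by (simp add: altruns_B_def)
qed

lemma R_B_eq_0:
  assumes "n \<ge> 1" "i > n"
  shows "R_B_gt s n i = 0" "R_B_lt s n i = 0"
proof -
  have "altruns_B n \<pi> \<noteq> i" for \<pi>
    using altruns_B_le[OF assms(1), of \<pi>] assms(2) by simp
  then show "R_B_gt s n i = 0" "R_B_lt s n i = 0"
    by (simp_all add: R_B_gt_def R_B_lt_def)
qed

end

theory Submission
  imports Defs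
begin

text \<open>Negating the letters \<open>\<pi> j, \<dots>, \<pi> n\<close> for \<open>j \<ge> 2\<close> reverses every comparison inside this
  suffix. It therefore affects a change of direction only at \<open>j - 1\<close> and \<open>j\<close>, and it changes their
  number by exactly one. If the suffix has even length, then the parity of \<open>inv_B\<close> is preserved,
  and so is the first letter. The suffixes of length \<open>2, 4, \<dots>, 2 * k + 2\<close> thus give \<open>k + 1\<close>
  sign-reversing involutions for \<open>(- 1) ^ altruns_B\<close>, and every change of direction is affected by
  at most one of them. Each monomial in the expansion of \<open>altruns_B ^ k\<close> involves at most \<open>k\<close>
  changes of direction, so some involution leaves it invariant and its signed sum vanishes.\<close>

section \<open>Signed power sums under a family of involutions\<close>

text \<open>Induction on \<open>k\<close>: one factor \<open>r x\<close> is expanded by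
  \<open>r_eq\<close>, and each chosen \<open>c i\<close> moves into the weight \<open>h\<close>, at
  the cost of removing from \<open>J\<close> the one index that may disturb it. When no factor is
  left, \<open>J\<close> is still nonempty, and any remaining \<open>f j\<close> pairs summands of
  opposite sign.\<close>

lemma signed_sum_power_eq_0:
  fixes r :: "'a \<Rightarrow> nat" and h :: "'a \<Rightarrow> int" and c :: "'b \<Rightarrow> 'a \<Rightarrow> int"
  assumes closed: "\<And>j x. j \<in> J \<Longrightarrow> x \<in> S \<Longrightarrow> f j x \<in> S"
    and invol: "\<And>j x. j \<in> J \<Longrightarrow> x \<in> S \<Longrightarrow> f j (f j x) = x"
    and parity: "\<And>j x. j \<in> J \<Longrightarrow> x \<in> S \<Longrightarrow> even (r (f j x)) \<longleftrightarrow> odd (r x)"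
    and r_eq: "\<And>x. x \<in> S \<Longrightarrow> int (r x) = a + (\<Sum>i\<in>I. c i x)"
    and local: "\<And>i. i \<in> I \<Longrightarrow> \<exists>d. \<forall>j\<in>J - {d}. \<forall>x\<in>S. c i (f j x) = c i x"
    and "k < card J"
    and "\<And>j x. j \<in> J \<Longrightarrow> x \<in> S \<Longrightarrow> h (f j x) = h x"
  shows "(\<Sum>x\<in>S. (-1) ^ r x * h x * int (r x) ^ k) = 0"
  using assms
proof (induction k arbitrary: h J)
  case 0
  then obtain j where j: "j \<in> J"
    by (metis card.empty equals0I less_irrefl)
  have "(\<Sum>x\<in>S. (-1) ^ r x * h x) = (\<Sum>x\<in>S. (-1) ^ r (f j x) * h (f j x))"
    by (rule sum.reindex_bij_witness[of _ "f j" "f j"]) (use 0 j in auto)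
  also have "\<dots> = (\<Sum>x\<in>S. - ((-1) ^ r x * h x))"
    by (rule sum.cong) (use 0(3,7) j in \<open>auto simp: minus_one_power_iff\<close>)
  finally show ?case
    by (simp add: sum_negf)
next
  case (Suc k)
  \<comment> \<open>The constant term \<open>a\<close> leaves \<open>h\<close> unchanged and costs
    no involution.\<close>
  have "(\<Sum>x\<in>S. (-1) ^ r x * h x * int (r x) ^ k) = 0"
    by (rule Suc.IH[OF Suc.prems(1-5)]) (use Suc.prems(6,7) in auto)
  moreover have "(\<Sum>x\<in>S. (-1) ^ r x * (h x * c i x) * int (r x) ^ k) = 0"
    if i: "i \<in> I" for i
  proof -
    obtain d where d: "\<forall>j\<in>J - {d}. \<forall>x\<in>S. c i (f j x) = c i x"
      using Suc.prems(5)[OF i] by blast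
    have "k < card (J - {d})"
      using Suc.prems(6) by (cases "d \<in> J") (auto simp: card_Diff_singleton_if)
    moreover have "\<exists>d'. \<forall>j\<in>J - {d} - {d'}. \<forall>x\<in>S. c i' (f j x) = c i' x" if "i' \<in> I" for i'
      using Suc.prems(5)[OF that] by blast
    ultimately show ?thesis
      using Suc.IH[of "J - {d}" "\<lambda>x. h x * c i x"] Suc.prems(1-4,7) d by simp
  qed
  moreover have "(\<Sum>x\<in>S. (-1) ^ r x * h x * int (r x) ^ Suc k) =
      a * (\<Sum>x\<in>S. (-1) ^ r x * h x * int (r x) ^ k) +
      (\<Sum>i\<in>I. \<Sum>x\<in>S. (-1) ^ r x * (h x * c i x) * int (r x) ^ k)"
  proof -
    have "(\<Sum>x\<in>S. (-1) ^ r x * h x * int (r x) ^ Suc k) =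
        (\<Sum>x\<in>S. (-1) ^ r x * h x * int (r x) ^ k * (a + (\<Sum>i\<in>I. c i x)))"
      using Suc.prems(4) by (intro sum.cong) (auto simp: mult_ac)
    also have "\<dots> = a * (\<Sum>x\<in>S. (-1) ^ r x * h x * int (r x) ^ k) +
        (\<Sum>x\<in>S. \<Sum>i\<in>I. (-1) ^ r x * (h x * c i x) * int (r x) ^ k)"
      by (simp add: distrib_left sum.distrib sum_distrib_left mult_ac)
    also have "(\<Sum>x\<in>S. \<Sum>i\<in>I. (-1) ^ r x * (h x * c i x) * int (r x) ^ k) =
        (\<Sum>i\<in>I. \<Sum>x\<in>S. (-1) ^ r x * (h x * c i x) * int (r x) ^ k)"
      by (rule sum.swap)
    finally show ?thesis .
  qed
  ultimately show ?case
    by simp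
qed

section \<open>Negating a suffix\<close>

text \<open>There is no upper end: a signed permutation vanishes beyond \<open>n\<close>, where
  negation does nothing.\<close>

definition negate_from :: "nat \<Rightarrow> (nat \<Rightarrow> int) \<Rightarrow> nat \<Rightarrow> int" where
  "negate_from j \<pi> i = (if j \<le> i then - \<pi> i else \<pi> i)"

lemma negate_from_negate_from [simp]: "negate_from j (negate_from j \<pi>) = \<pi>"
  by (auto simp: negate_from_def)

lemma abs_negate_from [simp]: "\<bar>negate_from j \<pi> i\<bar> = \<bar>\<pi> i\<bar>"
  by (simp add: negate_from_def)

lemma negate_from_eq_0_iff [simp]: "negate_from j \<pi> i = 0 \<longleftrightarrow> \<pi> i = 0"
  by (simp add: negate_from_def)

lemma negate_from_in_signed_perms: "\<pi> \<in> signed_perms n \<Longrightarrow> negate_from j \<pi> \<in> signed_perms n"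
  by (simp add: signed_perms_def)

lemma finite_signed_perms: "finite (signed_perms n)"
proof (rule finite_subset)
  show "signed_perms n \<subseteq>
      {\<pi>. \<forall>i. (i \<in> {1..n} \<longrightarrow> \<pi> i \<in> {- int n..int n}) \<and> (i \<notin> {1..n} \<longrightarrow> \<pi> i = 0)}"
  proof
    fix \<pi> assume \<pi>: "\<pi> \<in> signed_perms n"
    have "\<bar>\<pi> i\<bar> \<in> {1..int n}" if "i \<in> {1..n}" for i
      using \<pi> that by (auto simp: signed_perms_def dest!: bij_betw_apply)
    with \<pi> show "\<pi> \<in> {\<pi>. \<forall>i. (i \<in> {1..n} \<longrightarrow> \<pi> i \<in> {- int n..int n}) \<and> (i \<notin> {1..n} \<longrightarrow> \<pi> i = 0)}"
      by (fastforce simp: signed_perms_def abs_le_iff)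
  qed
qed (rule finite_set_of_finite_funs; simp)

text \<open>Absolute values keep comparisons strict when letters are negated. The case
  \<open>i = 0\<close> shows that letters are nonzero and covers the role of \<open>\<pi> 0\<close>
  in a change of direction at 1.\<close>

lemma signed_perms_abs_neq:
  assumes "\<pi> \<in> signed_perms n" "i < j" "j \<le> n"
  shows "\<bar>\<pi> i\<bar> \<noteq> \<bar>\<pi> j\<bar>"
proof (cases "i = 0")
  case True
  have "\<bar>\<pi> j\<bar> \<in> {1..int n}"
    using assms bij_betw_apply[of "\<lambda>i. \<bar>\<pi> i\<bar>" "{1..n}" "{1..int n}" j]
    by (simp add: signed_perms_def)
  then show ?thesis
    using assms(1) True by (auto simp: signed_perms_def)
next
  case False
  then show ?thesis
    using assms by (auto simp: signed_perms_def bij_betw_def dest!: inj_onD)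
qed

section \<open>Changes of direction\<close>

text \<open>The positions \<open>i - 1\<close>, \<open>i\<close>, \<open>i + 1\<close> lie all
  inside or all before the suffix; inside it, peaks and valleys are exchanged.\<close>

lemma changes_direction_negate_from:
  assumes "i \<noteq> j" "i \<noteq> j - 1" "i \<ge> 1"
  shows "changes_direction (negate_from j \<pi>) i \<longleftrightarrow> changes_direction \<pi> i"
proof -
  consider "j \<le> i - 1" | "i + 1 < j"
    using assms by linarith
  then show ?thesis
    by cases (auto simp: changes_direction_def negate_from_def)
qed

lemma altruns_B_eq_sum:
  "altruns_B n \<pi> = 1 + (\<Sum>i\<in>{1..n - 1}. of_bool (changes_direction \<pi> i))"
proof -
  have "{i. 1 \<le> i \<and> i \<le> n - 1 \<and> changes_direction \<pi> i} = {i \<in> {1..n - 1}. changes_direction \<pi> i}"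
    by auto
  then show ?thesis
    by (simp add: altruns_B_def Int_def sum.If_cases of_bool_def)
qed

text \<open>Modulo 2, the changes at \<open>j - 1\<close> and \<open>j\<close> together only compare
  the step from \<open>j - 2\<close> to \<open>j - 1\<close> with the step from \<open>j\<close> to
  \<open>j + 1\<close>, as the step between them cancels. Negation keeps the former and reverses the
  latter.\<close>

lemma even_altruns_B_negate_from:
  assumes \<pi>: "\<pi> \<in> signed_perms n" and j: "2 \<le> j" "j < n"
  shows "even (altruns_B n (negate_from j \<pi>)) \<longleftrightarrow> odd (altruns_B n \<pi>)"
proof -
  let ?c = "\<lambda>\<pi> i. of_bool (changes_direction \<pi> i) :: nat"
  have split: "altruns_B n \<rho> = 1 + ?c \<rho> (j - 1) + ?c \<rho> j + (\<Sum>i\<in>{1..n - 1} - {j - 1, j}. ?c \<rho> i)"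
    for \<rho>
  proof -
    have "(\<Sum>i\<in>{1..n - 1}. ?c \<rho> i) = (\<Sum>i\<in>{1..n - 1} - {j - 1, j}. ?c \<rho> i) + (\<Sum>i\<in>{j - 1, j}. ?c \<rho> i)"
      by (rule sum.subset_diff) (use j in auto)
    then show ?thesis
      using j by (simp add: altruns_B_eq_sum)
  qed
  have rest: "(\<Sum>i\<in>{1..n - 1} - {j - 1, j}. ?c (negate_from j \<pi>) i) =
      (\<Sum>i\<in>{1..n - 1} - {j - 1, j}. ?c \<pi> i)"
    by (rule sum.cong) (auto simp: changes_direction_negate_from)
  obtain l where l: "j = Suc (Suc l)"
    using j by (metis add_2_eq_Suc le_Suc_ex)
  \<comment> \<open>These are the letters at \<open>j - 2\<close> to \<open>j + 1\<close>; for
    \<open>j = 2\<close> the first is \<open>\<pi> 0\<close>, and \<open>j < n\<close> provides the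
    last.\<close>
  have "\<bar>\<pi> l\<bar> \<noteq> \<bar>\<pi> (l + 1)\<bar>" "\<bar>\<pi> (l + 1)\<bar> \<noteq> \<bar>\<pi> (l + 2)\<bar>" "\<bar>\<pi> (l + 2)\<bar> \<noteq> \<bar>\<pi> (l + 3)\<bar>"
    using signed_perms_abs_neq[OF \<pi>] j l by simp_all
  then have "even (?c (negate_from j \<pi>) (j - 1) + ?c (negate_from j \<pi>) j) \<longleftrightarrow>
      odd (?c \<pi> (j - 1) + ?c \<pi> j)"
    by (auto simp: l changes_direction_def negate_from_def eval_nat_numeral)
  then show ?thesis
    unfolding split rest by (simp del: sum_of_bool_eq)
qed

section \<open>Parity of \<open>inv_B\<close>\<close>

text \<open>\<open>Negs\<close> collects values, the last sum counts positions; they agree because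
  letters are distinct.\<close>

lemma inv_B_eq_sum:
  assumes "\<pi> \<in> signed_perms n"
  shows "inv_B n \<pi> =
    (\<Sum>(i, j)\<in>{(i, j). 1 \<le> i \<and> i < j \<and> j \<le> n}. of_bool (\<pi> i > \<pi> j) + of_bool (- \<pi> i > \<pi> j)) +
    (\<Sum>i\<in>{1..n}. of_bool (\<pi> i < 0))"
proof -
  let ?P = "{(i, j). 1 \<le> i \<and> i < j \<and> j \<le> n}"
  have fin: "finite ?P"
    by (rule finite_subset[of _ "{1..n} \<times> {1..n}"]) auto
  have card: "card {(i, j). 1 \<le> i \<and> i < j \<and> j \<le> n \<and> Q i j} = (\<Sum>(i, j)\<in>?P. of_bool (Q i j))" for Q
  proof -
    have "{(i, j). 1 \<le> i \<and> i < j \<and> j \<le> n \<and> Q i j} = {p \<in> ?P. case p of (i, j) \<Rightarrow> Q i j}"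
      by auto
    then show ?thesis
      using fin by (simp add: case_prod_unfold Int_def of_bool_def sum.If_cases)
  qed
  have "Negs n \<pi> = \<pi> ` {i \<in> {1..n}. \<pi> i < 0}"
    by (auto simp: Negs_def)
  moreover have "inj_on \<pi> {i \<in> {1..n}. \<pi> i < 0}"
    by (rule linorder_inj_onI) (use signed_perms_abs_neq[OF assms] in force)+
  ultimately have "card (Negs n \<pi>) = card {i \<in> {1..n}. \<pi> i < 0}"
    by (simp only: card_image)
  also have "\<dots> = (\<Sum>i\<in>{1..n}. of_bool (\<pi> i < 0))"
    by (simp add: Int_def of_bool_def sum.If_cases)
  finally show ?thesis
    unfolding inv_B_def card by (simp add: sum.distrib case_prod_unfold)
qed

text \<open>The two indicators of a pair add up to 1 if its first letter is larger in absolute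
  value, and to 0 or 2 otherwise, so their parity ignores signs. The number of negative letters
  changes parity once per letter of the suffix, whose length \<open>n - j + 1\<close> is
  even.\<close>

lemma even_inv_B_negate_from:
  assumes \<pi>: "\<pi> \<in> signed_perms n" and j: "1 \<le> j" "j \<le> n" "odd (n - j)"
  shows "even (inv_B n (negate_from j \<pi>)) \<longleftrightarrow> even (inv_B n \<pi>)"
proof -
  let ?\<rho> = "negate_from j \<pi>"
  let ?g = "\<lambda>\<pi> (i, j). of_bool (\<pi> i > \<pi> j) + of_bool (- \<pi> i > (\<pi> j :: int)) :: nat"
  let ?P = "{(i, j). 1 \<le> i \<and> i < j \<and> j \<le> n}"
  have "even (?g ?\<rho> p + ?g \<pi> p)" if p: "p \<in> ?P" for p
  proof -
    obtain u v where "p = (u, v)" "u < v" "v \<le> n"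
      using p by auto
    with signed_perms_abs_neq[OF \<pi>, of u v] show ?thesis
      by (auto simp: negate_from_def)
  qed
  then have "even (\<Sum>p\<in>?P. ?g ?\<rho> p + ?g \<pi> p)"
    by (intro dvd_sum) blast
  moreover have "even (\<Sum>i\<in>{1..n}. of_bool (?\<rho> i < 0) + of_bool (\<pi> i < 0) :: nat)"
  proof -
    have nz: "\<pi> i \<noteq> 0" if "i \<in> {1..n}" for i
      using signed_perms_abs_neq[OF \<pi>, of 0 i] \<pi> that by (auto simp: signed_perms_def)
    \<comment> \<open>Before \<open>j\<close> the two indicators coincide; from \<open>j\<close> on
      exactly one of them is 1, as the letter is nonzero.\<close>
    have "(\<Sum>i\<in>{1..n}. of_bool (?\<rho> i < 0) + of_bool (\<pi> i < 0) :: nat) =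
        (\<Sum>i\<in>{1..<j}. of_bool (?\<rho> i < 0) + of_bool (\<pi> i < 0)) +
        (\<Sum>i\<in>{j..n}. of_bool (?\<rho> i < 0) + of_bool (\<pi> i < 0))"
      by (subst sum.union_disjoint[symmetric]) (use j in \<open>auto intro: sum.cong\<close>)
    also have "(\<Sum>i\<in>{j..n}. of_bool (?\<rho> i < 0) + of_bool (\<pi> i < 0) :: nat) = (\<Sum>i\<in>{j..n}. 1)"
      by (rule sum.cong) (use nz j in \<open>force simp: negate_from_def\<close>)+
    also have "(\<Sum>i\<in>{1..<j}. of_bool (?\<rho> i < 0) + of_bool (\<pi> i < 0) :: nat) =
        (\<Sum>i\<in>{1..<j}. 2 * of_bool (\<pi> i < 0))"
      by (rule sum.cong) (auto simp: negate_from_def)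
    finally show ?thesis
      using j by (simp add: sum_distrib_left[symmetric] Suc_diff_le)
  qed
  ultimately have "even (inv_B n ?\<rho> + inv_B n \<pi>)"
    unfolding inv_B_eq_sum[OF \<pi>] inv_B_eq_sum[OF negate_from_in_signed_perms[OF \<pi>]]
    by (simp add: sum.distrib case_prod_unfold)
  then show ?thesis
    by simp
qed

section \<open>Power sums of alternating runs\<close>

lemma signed_sum_altruns_B_power_eq_0:
  assumes n: "n \<ge> 2 * k + 3" and S: "S \<subseteq> signed_perms n"
    and closed: "\<And>j \<pi>. \<lbrakk>2 \<le> j; j < n; odd (n - j); \<pi> \<in> S\<rbrakk> \<Longrightarrow> negate_from j \<pi> \<in> S"
  shows "(\<Sum>\<pi>\<in>S. (-1) ^ altruns_B n \<pi> * int (altruns_B n \<pi>) ^ k) = 0"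
proof -
  \<comment> \<open>The suffix starting at \<open>n - 1 - 2 * l\<close> has length
    \<open>2 * l + 2\<close>. The smallest start, \<open>n - 1 - 2 * k\<close>, is at least 2 by the
    bound on \<open>n\<close>.\<close>
  define J where "J = (\<lambda>l. n - 1 - 2 * l) ` {..k}"
  have J: "2 \<le> j \<and> j < n \<and> odd (n - j)" if j: "j \<in> J" for j
  proof -
    obtain l where "l \<le> k" "j = n - 1 - 2 * l"
      using j by (auto simp: J_def)
    moreover from this have "n - j = 2 * l + 1"
      using n by linarith
    ultimately show ?thesis
      using n by simp
  qed
  have "card J = k + 1"
    unfolding J_def by (subst card_image) (use n in \<open>auto simp: inj_on_def\<close>)
  \<comment> \<open>The factor 1 is the initial weight \<open>h\<close>.\<close>
  have "(\<Sum>\<pi>\<in>S. (-1) ^ altruns_B n \<pi> * 1 * int (altruns_B n \<pi>) ^ k) = 0"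
  proof (rule signed_sum_power_eq_0[where J = J and f = negate_from and a = 1 and
        I = "{1..n - 1}" and c = "\<lambda>i \<pi>. of_bool (changes_direction \<pi> i)"])
    show "negate_from j \<pi> \<in> S" if "j \<in> J" "\<pi> \<in> S" for j \<pi>
      using closed J that by blast
    show "even (altruns_B n (negate_from j \<pi>)) = odd (altruns_B n \<pi>)" if "j \<in> J" "\<pi> \<in> S" for j \<pi>
      using even_altruns_B_negate_from S J that by blast
    show "\<exists>d. \<forall>j\<in>J - {d}. \<forall>\<pi>\<in>S. (of_bool (changes_direction (negate_from j \<pi>) i) :: int) =
        of_bool (changes_direction \<pi> i)" if "i \<in> {1..n - 1}" for i
    proof -
      \<comment> \<open>All elements of \<open>J\<close> have the same parity, so at most one of \<open>i\<close>, \<open>i + 1\<close> lies in \<open>J\<close>.\<close>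
      define d where "d = (if odd (n - i) then i else i + 1)"
      have "i \<noteq> j \<and> i \<noteq> j - 1" if "j \<in> J - {d}" for j
        using J[of j] that by (auto simp: d_def split: if_splits)
      then show ?thesis
        using that by (intro exI[of _ d]) (simp add: changes_direction_negate_from)
    qed
  qed (simp_all add: altruns_B_eq_sum \<open>card J = k + 1\<close>)
  then show ?thesis
    by simp
qed

text \<open>Grouping the vanishing sum by the value of \<open>r\<close> gives the even-indexed terms
  minus the odd-indexed ones.\<close>

lemma odd_sum_eq_even_sum:
  fixes r :: "'a \<Rightarrow> nat"
  assumes fin: "finite S" and r: "\<And>x. x \<in> S \<Longrightarrow> r x \<in> {1..n}"
    and zero: "(\<Sum>x\<in>S. (-1) ^ r x * int (r x) ^ k) = 0"
  shows "(\<Sum>i | i \<in> {1..n} \<and> odd i. i ^ k * card {x \<in> S. r x = i}) =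
    (\<Sum>i | i \<in> {1..n} \<and> even i. i ^ k * card {x \<in> S. r x = i})"
proof -
  let ?t = "\<lambda>i. int (i ^ k * card {x \<in> S. r x = i})"
  have "0 = (\<Sum>i\<in>{1..n}. \<Sum>x | x \<in> S \<and> r x = i. (-1) ^ r x * int (r x) ^ k)"
    using zero fin r by (subst sum.group) auto
  also have "\<dots> = (\<Sum>i\<in>{1..n}. (-1) ^ i * ?t i)"
    by (intro sum.cong) (auto simp: mult_ac)
  also have "\<dots> = (\<Sum>i\<in>{1..n}. if even i then ?t i else - ?t i)"
    by (intro sum.cong) auto
  also have "\<dots> = (\<Sum>i | i \<in> {1..n} \<and> even i. ?t i) - (\<Sum>i | i \<in> {1..n} \<and> odd i. ?t i)"
    by (simp add: sum.If_cases Int_def sum_negf)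
  finally show ?thesis
    by (simp flip: of_nat_sum of_nat_mult of_nat_power)
qed

lemma odd_altruns_B_sum_eq_even_sum:
  assumes n: "n \<ge> 2 * k + 3" and S: "S \<subseteq> signed_perms n"
    and closed: "\<And>j \<pi>. \<lbrakk>2 \<le> j; j < n; odd (n - j); \<pi> \<in> S\<rbrakk> \<Longrightarrow> negate_from j \<pi> \<in> S"
  shows "(\<Sum>i | i \<in> {1..n} \<and> odd i. i ^ k * card {\<pi> \<in> S. altruns_B n \<pi> = i}) =
    (\<Sum>i | i \<in> {1..n} \<and> even i. i ^ k * card {\<pi> \<in> S. altruns_B n \<pi> = i})"
proof (rule odd_sum_eq_even_sum)
  show "finite S"
    using S finite_signed_perms by (rule finite_subset)
  show "altruns_B n \<pi> \<in> {1..n}" for \<pi>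
    using altruns_B_le[of n \<pi>] n by (simp add: altruns_B_def)
  show "(\<Sum>\<pi>\<in>S. (-1) ^ altruns_B n \<pi> * int (altruns_B n \<pi>) ^ k) = 0"
    using assms by (rule signed_sum_altruns_B_power_eq_0)
qed

lemma negate_from_in_signed_perms_sign:
  assumes "\<pi> \<in> signed_perms_sign s n" "1 \<le> j" "j \<le> n" "odd (n - j)"
  shows "negate_from j \<pi> \<in> signed_perms_sign s n"
  using assms by (cases s) (simp_all add: even_inv_B_negate_from negate_from_in_signed_perms)

theorem theorem13:
  fixes k n :: nat and s :: sign
  assumes "k > 0" and "n \<ge> 2 * k + 3"
  shows "(\<Sum>i | i \<in> {1..n} \<and> odd i. i ^ k * R_B_gt s n i) =
           (\<Sum>i | i \<in> {1..n} \<and> even i. i ^ k * R_B_gt s n i)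
       \<and> (\<Sum>i | i \<in> {1..n} \<and> odd i. i ^ k * R_B_lt s n i) =
           (\<Sum>i | i \<in> {1..n} \<and> even i. i ^ k * R_B_lt s n i)"
  unfolding R_B_gt_def R_B_lt_def
proof (intro conjI odd_altruns_B_sum_eq_even_sum)
  fix j \<pi> assume j: "2 \<le> j" "j < n" "odd (n - j)"
  \<comment> \<open>As \<open>2 \<le> j\<close>, the first letter precedes the suffix, so its sign
    is kept.\<close>
  then have first: "negate_from j \<pi> (Suc 0) = \<pi> (Suc 0)"
    by (simp add: negate_from_def)
  show "negate_from j \<pi> \<in> signed_perms_gt n \<inter> signed_perms_sign s n"
    if "\<pi> \<in> signed_perms_gt n \<inter> signed_perms_sign s n"
    using that j negate_from_in_signed_perms_sign[of \<pi> s n j]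
    by (simp add: signed_perms_gt_def negate_from_in_signed_perms first)
  show "negate_from j \<pi> \<in> signed_perms_lt n \<inter> signed_perms_sign s n"
    if "\<pi> \<in> signed_perms_lt n \<inter> signed_perms_sign s n"
    using that j negate_from_in_signed_perms_sign[of \<pi> s n j]
    by (simp add: signed_perms_lt_def negate_from_in_signed_perms first)
qed (use assms in \<open>auto simp: signed_perms_gt_def signed_perms_lt_def\<close>)

end
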